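(* Consider the three-dimensional curvilinear DGSEM semi-discretization of the compressible Euler equations with gravity for the set of conserved variables $(\varrho,\varrho\vec V,\varrho E)$. The numerical non-conservative surface and volume fluxes and numerical conservative surface and volume fluxes are total energy-conservative (TEC, including the potential energy) if the numerical density flux and the non-conservative fluxes are of the form $$\vec f^{\varrho,*}=\vec f^{\varrho,\mathrm{vol}}=\overline\varrho\,\{\!\{\vec V\}\!\},\qquad \vec g^{\varrho\vec V,*}=\vec g^{\varrho\vec V,\mathrm{vol}}=\overline\varrho\,[\![\phi]\!],\qquad \vec g^{\varrho E,*}=\vec g^{\varrho E,\mathrm{vol}}=\vec f^{\varrho}\,[\![\phi]\!].$$
   Context: Equations: $\partial_t\varrho+\nabla\cdot(\varrho\vec V)=0$, $\partial_t(\varrho\vec V)+\nabla\cdot(\varrho\vec V\otimes\vec V)+\nabla p+\varrho\nabla\phi=0$, $\partial_t(\varrho E)+\nabla\cdot((\varrho E+p)\vec V)+\varrho\vec V\cdot\nabla\phi=0$, where $\varrho E=\frac p{\gamma-1}+\frac12\varrho\|\vec V\|^2$ is internal plus kinetic energy, $\vec V=(v_1,v_2,v_3)$, $\gamma>1$, and $\phi(x,y,z)$ is a time-independent geopotential. For an ordered pair of nodes with values $a_-$ (first), $a_+$ (second): $\{\!\{a\}\!\}=(a_-+a_+)/2$, $[\![a]\!]=a_+-a_-$. $\overline\varrho$ is a symmetric two-point mean of the density with $\overline\varrho=\varrho$ if both densities equal $\varrho$. Two-point conservative fluxes $f^{d}$ in the Cartesian directions $d=1,2,3$ (volume and surface versions)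 are symmetric and consistent with the exact fluxes; their density component is $f^d_\varrho=\overline\varrho\{\!\{v_d\}\!\}$. The two-point non-conservative term $g^d$ has zero mass component, momentum component $c$ equal to $\delta_{cd}\,\overline\varrho\,[\![\phi]\!]$ and energy component $f^d_\varrho\,[\![\phi]\!]$. Write $\overset{\leftrightarrow}f=(f^1,f^2,f^3)$, $\overset{\leftrightarrow}g=(g^1,g^2,g^3)$; $\overset{\leftrightarrow}f\cdot\vec a=\sum_da_df^d$. DGSEM: on each hexahedral element mapped from $[-1,1]^3$, with tensor-product Lobatto–Gauss–Legendre nodes $(i,j,k)\in\{0,\dots,N\}^3$, 1D weights $\omega_i$, $\omega_{ij}=\omega_i\omega_j$, $\omega_{ijk}=\omega_i\omega_j\omega_k$, Lagrange derivative matrix $D_{ij}=l_j'(\xi_i)$, $Q_{ij}=\omega_iD_{ij}$ ($Q+Q^T=\mathrm{diag}(-1,0,\dots,0,1)$, $\sum_jQ_{ij}=0$), mapping Jacobian $J_{ijk}>0$ and contravariant metric vectors $J\vec a^1,J\vec a^2,J\vec a^3\in\mathbb R^3$ at the nodes, the scheme is $J_{ijk}\omega_{ijk}\dot u_{ijk}=\mathcal F^1_{ijk}+\mathcal F^2_{ijk}+\mathcal F^3_{ijk}$ with $$\mathcal F^1_{ijk}=\omega_{jk}\Big(-2\sum_mQ_{im}\tilde f^{1,\mathrm{vol}}_{(i,m)jk}-\sum_mQ_{im}\tilde g^{1,\mathrm{vol}}_{(i,m)jk}-\delta_{i0}[\overset{\leftrightarrow}f\cdot J\vec a^1]_{0jk}+\delta_{iN}[\overset{\leftrightarrow}f\cdot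 J\vec a^1]_{Njk}+\delta_{i0}[\tilde f^*_{(0,L)jk}+\tfrac12\tilde g^*_{(0,L)jk}]-\delta_{iN}[\tilde f^*_{(N,R)jk}+\tfrac12\tilde g^*_{(N,R)jk}]\Big),$$ and $\mathcal F^2,\mathcal F^3$ defined analogously in the second index (with $\omega_{ik}$, $J\vec a^2$) and third index (with $\omega_{ij}$, $J\vec a^3$). Here $[\overset{\leftrightarrow}f\cdot J\vec a^1]$ uses the exact fluxes, $\tilde f^{1,\mathrm{vol}}_{(i,m)jk}=\overset{\leftrightarrow}f{}^{\mathrm{vol}}(u_{ijk},u_{mjk})\cdot\{\!\{J\vec a^1\}\!\}_{(i,m)jk}$, $\tilde g^{1,\mathrm{vol}}_{(i,m)jk}=\overset{\leftrightarrow}g{}^{\mathrm{vol}}(u_{ijk},u_{mjk})\cdot\{\!\{J\vec a^1\}\!\}_{(i,m)jk}$ (jump $\phi_{mjk}-\phi_{ijk}$), the starred surface quantities are defined by the same formulas with $f^*,g^*$, and $L$, $R$ denote the coincident node of the neighbouring element at the lower/upper face (jump = neighbour minus own). The mesh is conforming, neighbouring elements have aligned reference directions and the metric vectors $J\vec a^m$ normal to a shared face agree from both sides. TEC: with $U=\varrho E+\varrho\phi$, on every element $\frac{d}{dt}\sum_{i,j,k}J_{ijk}\omega_{ijk}U_{ijk}$ equals minus the sum over the three directions of (upper face minus lower face) weighted sums of interface values, e.g. $-\sum_{j,k}\omega_{jk}(H_{(N,R)jk}-H_{(0,L)jk})$ in direction 1, where each interface value $H$ is a two-point function of the states and potentials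 on the two sides and of the face metric vector, with a single value shared by the two adjacent elements. *)

theory Defs
  imports "HOL-Analysis.Analysis" "HOL-Computational_Algebra.Polynomial"
begin

section \<open>Euler equations with gravity\<close>

text \<open>
  A state is the triple of conserved variables: density, momentum, and internal plus kinetic
  energy (all per unit volume).  Both physical and reference directions are indexed by the
  type \<open>3\<close>, with elements \<open>1, 2, 3\<close> (and \<open>3 = 0\<close>).
\<close>

type_synonym state = "real \<times> (real^3) \<times> real"

definition dens :: "state \<Rightarrow> real" where "dens u = fst u"
definition mom :: "state \<Rightarrow> real^3" where "mom u = fst (snd u)"
definition energy :: "state \<Rightarrow> real" where "energy u = snd (snd u)"

definition vel :: "state \<Rightarrow> real^3" where
  "vel u = (1 / dens u) *\<^sub>R mom u"

definition pressure :: "real \<Rightarrow> state \<Rightarrow> real" where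
  "pressure \<gamma> u = (\<gamma> - 1) * (energy u - 1/2 * dens u * (norm (vel u))^2)"

definition admissible :: "real \<Rightarrow> state \<Rightarrow> bool" where
  "admissible \<gamma> u \<longleftrightarrow> dens u > 0 \<and> pressure \<gamma> u > 0"

definition exact_flux :: "real \<Rightarrow> 3 \<Rightarrow> state \<Rightarrow> state" where
  "exact_flux \<gamma> d u =
     (dens u * vel u $ d,
      (dens u * vel u $ d) *\<^sub>R vel u + pressure \<gamma> u *\<^sub>R axis d 1,
      (energy u + pressure \<gamma> u) * vel u $ d)"

definition total_energy :: "state \<Rightarrow> real \<Rightarrow> real" where
  "total_energy u \<phi> = energy u + dens u * \<phi>"


section \<open>Two-point fluxes\<close>

definition mean2 :: "'a::real_vector \<Rightarrow> 'a \<Rightarrow> 'a" where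
  "mean2 a b = (1/2) *\<^sub>R (a + b)"

definition jump :: "'a::ab_group_add \<Rightarrow> 'a \<Rightarrow> 'a" where
  "jump a b = b - a"

definition density_mean :: "(real \<Rightarrow> real \<Rightarrow> real) \<Rightarrow> bool" where
  "density_mean \<rho>m \<longleftrightarrow>
     (\<forall>a>0. \<forall>b>0. \<rho>m a b = \<rho>m b a) \<and> (\<forall>a>0. \<rho>m a a = a)"

type_synonym cons_flux = "3 \<Rightarrow> state \<Rightarrow> state \<Rightarrow> state"

text \<open>Arguments: direction, first state and potential, second state and potential.\<close>

type_synonym noncons_flux = "3 \<Rightarrow> state \<Rightarrow> real \<Rightarrow> state \<Rightarrow> real \<Rightarrow> state"

definition symmetric_flux :: "real \<Rightarrow> cons_flux \<Rightarrow> bool" where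
  "symmetric_flux \<gamma> f \<longleftrightarrow>
     (\<forall>d a b. admissible \<gamma> a \<longrightarrow> admissible \<gamma> b \<longrightarrow> f d a b = f d b a)"

definition consistent_flux :: "real \<Rightarrow> cons_flux \<Rightarrow> bool" where
  "consistent_flux \<gamma> f \<longleftrightarrow> (\<forall>d a. admissible \<gamma> a \<longrightarrow> f d a a = exact_flux \<gamma> d a)"

definition contract :: "(3 \<Rightarrow> state) \<Rightarrow> real^3 \<Rightarrow> state" where
  "contract F n = (\<Sum>d\<in>UNIV. n $ d *\<^sub>R F d)"


section \<open>Lobatto--Gauss--Legendre collocation\<close>

text \<open>Rodrigues' formula.\<close>

definition legendre :: "nat \<Rightarrow> real poly" where
  "legendre N = smult (1 / (2 ^ N * fact N)) ((pderiv ^^ N) ([:-1, 0, 1:] ^ N))"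

text \<open>The nodes are the endpoints together with the zeros of \<open>P\<^sub>N'\<close>, in increasing order.\<close>

definition lgl_nodes :: "nat \<Rightarrow> (nat \<Rightarrow> real) \<Rightarrow> bool" where
  "lgl_nodes N \<xi> \<longleftrightarrow> N \<ge> 1 \<and> strict_mono_on {..N} \<xi> \<and> \<xi> 0 = -1 \<and> \<xi> N = 1 \<and>
     (\<forall>i. 0 < i \<and> i < N \<longrightarrow> poly (pderiv (legendre N)) (\<xi> i) = 0)"

definition lagrange :: "nat \<Rightarrow> (nat \<Rightarrow> real) \<Rightarrow> nat \<Rightarrow> real poly" where
  "lagrange N \<xi> j = (\<Prod>m\<in>{..N} - {j}. smult (1 / (\<xi> j - \<xi> m)) [:- \<xi> m, 1:])"

definition weight :: "nat \<Rightarrow> (nat \<Rightarrow> real) \<Rightarrow> nat \<Rightarrow> real" where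
  "weight N \<xi> i = integral {-1..1} (poly (lagrange N \<xi> i))"

definition Dmat :: "nat \<Rightarrow> (nat \<Rightarrow> real) \<Rightarrow> nat \<Rightarrow> nat \<Rightarrow> real" where
  "Dmat N \<xi> i j = poly (pderiv (lagrange N \<xi> j)) (\<xi> i)"

definition Qmat :: "nat \<Rightarrow> (nat \<Rightarrow> real) \<Rightarrow> nat \<Rightarrow> nat \<Rightarrow> real" where
  "Qmat N \<xi> i j = weight N \<xi> i * Dmat N \<xi> i j"

text \<open>
  A tensor-product node \<open>(i, j, k)\<close> is the function \<open>q\<close> with \<open>q 1 = i\<close>, \<open>q 2 = j\<close>, \<open>q 3 = k\<close>,
  so that \<open>q(d := m)\<close> replaces the index in direction \<open>d\<close> and the three directions can be
  treated uniformly.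
\<close>

type_synonym node = "3 \<Rightarrow> nat"

definition nodes :: "nat \<Rightarrow> node set" where
  "nodes N = {q. \<forall>d. q d \<le> N}"

definition vol_weight :: "nat \<Rightarrow> (nat \<Rightarrow> real) \<Rightarrow> node \<Rightarrow> real" where
  "vol_weight N \<xi> q = (\<Prod>b\<in>UNIV. weight N \<xi> (q b))"

definition face_weight :: "nat \<Rightarrow> (nat \<Rightarrow> real) \<Rightarrow> 3 \<Rightarrow> node \<Rightarrow> real" where
  "face_weight N \<xi> d q = (\<Prod>b\<in>UNIV - {d}. weight N \<xi> (q b))"


section \<open>Curvilinear conforming meshes\<close>

datatype side = Lower | Upper

fun opp :: "side \<Rightarrow> side" where
  "opp Lower = Upper"
| "opp Upper = Lower"

fun face_index :: "nat \<Rightarrow> side \<Rightarrow> nat" where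
  "face_index N Lower = 0"
| "face_index N Upper = N"

text \<open>
  \<open>elems\<close> are the elements on which the scheme is evolved; the neighbour of an element across a
  physical boundary is a label outside \<open>elems\<close>, whose nodal values are boundary data.
  \<open>metric M e d q\<close> is the vector \<open>J a\<^sup>d\<close> and \<open>phi M e q\<close> the geopotential at node \<open>q\<close> of \<open>e\<close>.
  The potential is nodal data of each element, so it may jump across element interfaces.
\<close>

record mesh =
  elems :: "nat set"
  nbr :: "side \<Rightarrow> 3 \<Rightarrow> nat \<Rightarrow> nat"
  jac :: "nat \<Rightarrow> node \<Rightarrow> real"
  metric :: "nat \<Rightarrow> 3 \<Rightarrow> node \<Rightarrow> real^3"
  phi :: "nat \<Rightarrow> node \<Rightarrow> real"

definition nbr_node :: "nat \<Rightarrow> side \<Rightarrow> 3 \<Rightarrow> node \<Rightarrow> node" where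
  "nbr_node N s d q = q(d := face_index N (opp s))"

definition conforming_mesh :: "nat \<Rightarrow> mesh \<Rightarrow> bool" where
  "conforming_mesh N M \<longleftrightarrow>
     (\<forall>e\<in>elems M. \<forall>q\<in>nodes N. jac M e q > 0) \<and>
     (\<forall>e\<in>elems M. \<forall>s d. nbr M s d e \<in> elems M \<longrightarrow> nbr M (opp s) d (nbr M s d e) = e) \<and>
     (\<forall>e\<in>elems M. \<forall>s d. \<forall>q\<in>nodes N. q d = face_index N s \<longrightarrow>
        metric M (nbr M s d e) d (nbr_node N s d q) = metric M e d q)"


section \<open>The DGSEM semi-discretization\<close>

definition vol_f where
  "vol_f f M u d e q r =
     contract (\<lambda>c. f c (u e q) (u e r)) (mean2 (metric M e d q) (metric M e d r))"
  for f :: cons_flux and u :: "nat \<Rightarrow> node \<Rightarrow> state"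

definition vol_g where
  "vol_g g M u d e q r =
     contract (\<lambda>c. g c (u e q) (phi M e q) (u e r) (phi M e r))
       (mean2 (metric M e d q) (metric M e d r))"
  for g :: noncons_flux and u :: "nat \<Rightarrow> node \<Rightarrow> state"

text \<open>Surface terms at a face node; the first argument is the own node, the second the neighbour's.\<close>

definition surf_f where
  "surf_f f N M u s d e q =
     (let e' = nbr M s d e; r = nbr_node N s d q in
      contract (\<lambda>c. f c (u e q) (u e' r)) (mean2 (metric M e d q) (metric M e' d r)))"
  for f :: cons_flux and u :: "nat \<Rightarrow> node \<Rightarrow> state"

definition surf_g where
  "surf_g g N M u s d e q =
     (let e' = nbr M s d e; r = nbr_node N s d q in
      contract (\<lambda>c. g c (u e q) (phi M e q) (u e' r) (phi M e' r))
        (mean2 (metric M e d q) (metric M e' d r)))"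
  for g :: noncons_flux and u :: "nat \<Rightarrow> node \<Rightarrow> state"

definition own_f where
  "own_f \<gamma> M u d e q = contract (\<lambda>c. exact_flux \<gamma> c (u e q)) (metric M e d q)"
  for u :: "nat \<Rightarrow> node \<Rightarrow> state"

definition rhs :: "real \<Rightarrow> cons_flux \<Rightarrow> noncons_flux \<Rightarrow> cons_flux \<Rightarrow> noncons_flux \<Rightarrow>
    nat \<Rightarrow> (nat \<Rightarrow> real) \<Rightarrow> mesh \<Rightarrow> (nat \<Rightarrow> node \<Rightarrow> state) \<Rightarrow> 3 \<Rightarrow> nat \<Rightarrow> node \<Rightarrow> state" where
  "rhs \<gamma> fvol gvol fsur gsur N \<xi> M u d e q =
     face_weight N \<xi> d q *\<^sub>R
       (- (2 *\<^sub>R (\<Sum>m\<le>N. Qmat N \<xi> (q d) m *\<^sub>R vol_f fvol M u d e q (q(d := m))))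
        - (\<Sum>m\<le>N. Qmat N \<xi> (q d) m *\<^sub>R vol_g gvol M u d e q (q(d := m)))
        - (if q d = 0 then own_f \<gamma> M u d e q else 0)
        + (if q d = N then own_f \<gamma> M u d e q else 0)
        + (if q d = 0
           then surf_f fsur N M u Lower d e q + (1/2) *\<^sub>R surf_g gsur N M u Lower d e q else 0)
        - (if q d = N
           then surf_f fsur N M u Upper d e q + (1/2) *\<^sub>R surf_g gsur N M u Upper d e q else 0))"

definition dgsem_solution :: "real \<Rightarrow> cons_flux \<Rightarrow> noncons_flux \<Rightarrow> cons_flux \<Rightarrow> noncons_flux \<Rightarrow>
    nat \<Rightarrow> (nat \<Rightarrow> real) \<Rightarrow> mesh \<Rightarrow> real set \<Rightarrow> (real \<Rightarrow> nat \<Rightarrow> node \<Rightarrow> state) \<Rightarrow> bool" where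
  "dgsem_solution \<gamma> fvol gvol fsur gsur N \<xi> M T u \<longleftrightarrow>
     is_interval T \<and>
     (\<forall>t\<in>T. \<forall>e\<in>elems M. \<forall>q\<in>nodes N. admissible \<gamma> (u t e q)) \<and>
     (\<forall>t\<in>T. \<forall>e\<in>elems M. \<forall>s d. \<forall>q\<in>nodes N. q d = face_index N s \<longrightarrow>
        admissible \<gamma> (u t (nbr M s d e) (nbr_node N s d q))) \<and>
     (\<forall>t\<in>T. \<forall>e\<in>elems M. \<forall>q\<in>nodes N. \<exists>du.
        ((\<lambda>\<tau>. u \<tau> e q) has_vector_derivative du) (at t within T) \<and>
        (jac M e q * vol_weight N \<xi> q) *\<^sub>R du =
          (\<Sum>d\<in>UNIV. rhs \<gamma> fvol gvol fsur gsur N \<xi> M (u t) d e q))"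


section \<open>Total energy conservation\<close>

text \<open>Arguments: own state and potential, neighbour's state and potential, face metric vector.\<close>

type_synonym interface_flux = "state \<Rightarrow> real \<Rightarrow> state \<Rightarrow> real \<Rightarrow> real^3 \<Rightarrow> real"

definition interface_value where
  "interface_value H N M u s d e q =
     (let e' = nbr M s d e; r = nbr_node N s d q in
      H (u e q) (phi M e q) (u e' r) (phi M e' r) (metric M e d q))"
  for H :: interface_flux and u :: "nat \<Rightarrow> node \<Rightarrow> state"

text \<open>
  One two-point function \<open>H\<close> serves all polynomial degrees, meshes and solutions.  The first
  conjunct says that the two elements adjacent to an interface obtain the same value of \<open>H\<close>; in
  the second, \<open>q\<close> with \<open>q d = 0\<close> runs over the pairs of indices tangential to direction \<open>d\<close>.
\<close>

definition total_energy_conservative ::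
  "real \<Rightarrow> cons_flux \<Rightarrow> noncons_flux \<Rightarrow> cons_flux \<Rightarrow> noncons_flux \<Rightarrow> bool" where
  "total_energy_conservative \<gamma> fvol gvol fsur gsur \<longleftrightarrow>
     (\<exists>H :: interface_flux. \<forall>N \<xi> M T u.
        lgl_nodes N \<xi> \<longrightarrow> conforming_mesh N M \<longrightarrow>
        dgsem_solution \<gamma> fvol gvol fsur gsur N \<xi> M T u \<longrightarrow>
        (\<forall>t\<in>T. \<forall>e\<in>elems M.
           (\<forall>d. \<forall>q\<in>nodes N. q d = N \<longrightarrow> nbr M Upper d e \<in> elems M \<longrightarrow>
              interface_value H N M (u t) Upper d e q =
              interface_value H N M (u t) Lower d (nbr M Upper d e) (q(d := 0))) \<and>
           ((\<lambda>\<tau>. \<Sum>q\<in>nodes N.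
                jac M e q * vol_weight N \<xi> q * total_energy (u \<tau> e q) (phi M e q))
            has_real_derivative
              - (\<Sum>d\<in>UNIV. \<Sum>q\<in>{q\<in>nodes N. q d = 0}.
                   face_weight N \<xi> d q *
                   (interface_value H N M (u t) Upper d e (q(d := N))
                    - interface_value H N M (u t) Lower d e q)))
           (at t within T)))"

end

theory Submission
  imports Defs
begin

text \<open>
  For a fixed geopotential the total energy \<open>\<rho>E + \<rho>\<phi>\<close> is linear in the conserved variables, so
  its rate of change at a node is the energy component of the right-hand side plus \<open>\<phi>\<close> times
  the density component.  In a pair of nodes \<open>a\<close>, \<open>b\<close> the conservative flux then contributes
  \<open>f\<^sup>E + \<phi>\<^sub>a f\<^sup>\<rho>\<close>, which is not symmetric, and half of the non-conservative energy term adds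
  \<open>f\<^sup>\<rho> (\<phi>\<^sub>b - \<phi>\<^sub>a) / 2\<close>.  The sum is \<open>f\<^sup>E + f\<^sup>\<rho> (\<phi>\<^sub>a + \<phi>\<^sub>b) / 2\<close>, a symmetric two-point flux of total
  energy (\<open>noncons_gives_energy_flux\<close>, \<open>energy_flux_commute\<close>).

  The rest is the usual flux-differencing argument.  Lobatto quadrature is exact for degree
  \<open>2N - 1\<close> (\<open>lobatto_exact\<close>), hence \<open>Q + Q\<^sup>T = diag(-1, 0, \<dots>, 0, 1)\<close>, and a symmetric two-point
  quantity summed against \<open>Q\<close> along a line of nodes reduces to its values at the two ends
  (\<open>Qmat_symmetric_sum\<close>).  By consistency these are the exact fluxes, which the surface terms
  cancel, so that only the interface fluxes remain (\<open>line_energy_balance\<close>).  The interface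
  value witnessing conservation is therefore the total energy flux of the surface fluxes; the
  two adjacent elements see the same value by symmetry and by agreement of the metric vectors
  (\<open>energy_flux_single_valued\<close>).
\<close>

section \<open>Lobatto quadrature\<close>

lemma integrable_poly [simp]: "poly p integrable_on {a..b::real}"
  by (intro integrable_continuous_real continuous_intros)

lemma integral_poly_pderiv:
  fixes p :: "real poly"
  assumes "a \<le> b"
  shows "integral {a..b} (poly (pderiv p)) = poly p b - poly p a"
proof (rule integral_unique, rule fundamental_theorem_of_calculus[OF assms])
  fix x assume "x \<in> {a..b}"
  show "(poly p has_vector_derivative poly (pderiv p) x) (at x within {a..b})"
    using poly_DERIV[of p x]
    by (simp add: has_real_derivative_iff_has_vector_derivative has_vector_derivative_at_within)
qed

lemma integral_poly_0: "integral S (poly 0) = (0::real)"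
proof -
  have "poly (0::real poly) = (\<lambda>x. 0)" by auto
  then show ?thesis by simp
qed

lemma integral_poly_add:
  "integral {a..b::real} (poly (p + q)) = integral {a..b} (poly p) + integral {a..b} (poly q)"
proof -
  have "poly (p + q) = (\<lambda>x. poly p x + poly q x)" by auto
  then show ?thesis by (simp add: integral_add)
qed

lemma integral_poly_smult:
  "integral {a..b::real} (poly (smult c p)) = c * integral {a..b} (poly p)"
proof -
  have "poly (smult c p) = (\<lambda>x. c * poly p x)" by auto
  then show ?thesis by simp
qed

lemma integral_poly_sum_smult:
  fixes c :: "'i \<Rightarrow> real"
  assumes "finite I"
  shows "integral {a..b} (poly (\<Sum>i\<in>I. smult (c i) (p i))) = (\<Sum>i\<in>I. c i * integral {a..b} (poly (p i)))"
  using assms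
proof (induction I rule: finite_induct)
  case empty
  then show ?case by (simp add: integral_poly_0)
next
  case (insert i I)
  show ?case
    by (simp only: sum.insert[OF insert.hyps] integral_poly_add integral_poly_smult insert.IH)
qed

lemma integral_poly_by_parts:
  fixes p q :: "real poly"
  assumes "a \<le> b"
  shows "integral {a..b} (poly (pderiv p * q)) =
    poly (p * q) b - poly (p * q) a - integral {a..b} (poly (p * pderiv q))"
proof -
  have "pderiv (p * q) = p * pderiv q + pderiv p * q"
    by (simp add: pderiv_mult mult.commute)
  then show ?thesis
    using integral_poly_pderiv[OF assms, of "p * q"] integral_poly_add[of a b "p * pderiv q" "pderiv p * q"]
    by simp
qed

lemma power_dvd_pderiv_iterate:
  fixes w :: "real poly"
  assumes "k \<le> N"
  shows "w ^ (N - k) dvd (pderiv ^^ k) (w ^ N)"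
  using assms
proof (induction k)
  case (Suc k)
  then obtain m where m: "N - k = Suc m" "N - Suc k = m" by (metis Suc_diff_Suc Suc_le_eq)
  obtain r where "(pderiv ^^ k) (w ^ N) = w ^ Suc m * r"
    using Suc m by (auto simp: dvd_def)
  then have "(pderiv ^^ Suc k) (w ^ N) = w ^ m * (w * pderiv r + smult (of_nat (Suc m)) (pderiv w) * r)"
    by (simp add: pderiv_mult pderiv_power_Suc algebra_simps del: power_Suc)
       (simp add: algebra_simps)
  then show ?case unfolding m by (metis dvd_triv_left)
qed simp

text \<open>
  Repeated integration by parts moves the derivatives onto \<open>s\<close>; the boundary terms vanish because
  derivatives of \<open>(x\<^sup>2 - 1)\<^sup>N\<close> of order less than \<open>N\<close> keep a factor \<open>x\<^sup>2 - 1\<close>.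
\<close>

lemma rodrigues_orthogonal:
  assumes "k \<le> N" "degree s < k \<or> s = 0"
  shows "integral {-1..1} (poly ((pderiv ^^ k) ([:-1, 0, 1:] ^ N) * s)) = (0::real)"
  using assms
proof (induction k arbitrary: s)
  case 0
  then show ?case by (simp add: integral_poly_0)
next
  case (Suc k)
  let ?w = "[:-1, 0, 1:] :: real poly"
  have "?w dvd ?w ^ (N - k)" using Suc.prems by (intro dvd_power) auto
  also have "\<dots> dvd (pderiv ^^ k) (?w ^ N)" using Suc.prems by (intro power_dvd_pderiv_iterate) auto
  finally obtain r where r: "(pderiv ^^ k) (?w ^ N) = ?w * r" by (auto simp: dvd_def)
  have "degree (pderiv s) < k \<or> pderiv s = 0"
    using Suc.prems by (cases "degree s") (auto simp: pderiv_eq_0_iff degree_pderiv)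
  then have "integral {-1..1} (poly ((pderiv ^^ k) (?w ^ N) * pderiv s)) = 0"
    using Suc.IH[of "pderiv s"] Suc.prems by (simp only: Suc_leD)
  then show ?case
    using integral_poly_by_parts[of "-1" 1 "(pderiv ^^ k) (?w ^ N)" s]
    unfolding funpow.simps comp_def by (simp only:) (simp add: r)
qed

lemma degree_pderiv_iterate:
  "degree ((pderiv ^^ k) p) = degree p - k" for p :: "real poly"
  by (induction k) (auto simp: degree_pderiv)

lemma degree_legendre: "degree (legendre N) = N"
  by (simp add: legendre_def degree_pderiv_iterate degree_power_eq)

lemma legendre_orthogonal:
  assumes "degree s < N \<or> s = 0"
  shows "integral {-1..1} (poly (legendre N * s)) = 0"
proof -
  have "legendre N * s = smult (1 / (2 ^ N * fact N)) ((pderiv ^^ N) ([:-1, 0, 1:] ^ N) * s)"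
    by (simp only: legendre_def mult_smult_left)
  then show ?thesis
    using rodrigues_orthogonal[of N N s] assms by (simp only: integral_poly_smult)
qed

lemma lagrange_at_node:
  assumes "inj_on \<xi> {..N}" "i \<le> N" "j \<le> N"
  shows "poly (lagrange N \<xi> j) (\<xi> i) = (if i = j then 1 else 0)"
proof (cases "i = j")
  case True
  have "\<xi> j \<noteq> \<xi> m" if "m \<in> {..N} - {j}" for m
    using assms that by (auto simp: inj_on_def)
  then show ?thesis using True
    by (auto simp: lagrange_def poly_prod diff_divide_distrib[symmetric] intro!: prod.neutral)
next
  case False
  then have "i \<in> {..N} - {j}" using assms by auto
  then show ?thesis using False
    by (auto simp: lagrange_def poly_prod intro!: prod_zero)
qed

lemma degree_lagrange_le:
  assumes "j \<le> N"
  shows "degree (lagrange N \<xi> j) \<le> N"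
proof -
  have "degree (lagrange N \<xi> j) \<le>
      (\<Sum>m\<in>{..N} - {j}. degree (smult (1 / (\<xi> j - \<xi> m)) [:- \<xi> m, 1:]))"
    unfolding lagrange_def by (rule order_trans[OF degree_prod_sum_le]) (simp_all add: comp_def)
  also have "\<dots> \<le> (\<Sum>m\<in>{..N} - {j}. 1)"
    by (intro sum_mono) (auto intro: order_trans[OF degree_smult_le])
  also have "\<dots> = N" using assms by simp
  finally show ?thesis .
qed

lemma lagrange_interpolation:
  assumes "inj_on \<xi> {..N}" "degree s \<le> N"
  shows "(\<Sum>i\<le>N. smult (poly s (\<xi> i)) (lagrange N \<xi> i)) = s" (is "?I = s")
proof (rule poly_eqI_degree[where A = "\<xi> ` {..N}"])
  have card: "card (\<xi> ` {..N}) = Suc N" using assms(1) by (simp add: card_image)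
  have "degree ?I \<le> N"
    by (intro degree_sum_le) (auto intro: order_trans[OF degree_smult_le] degree_lagrange_le)
  then show "card (\<xi> ` {..N}) > degree ?I" "card (\<xi> ` {..N}) > degree s" using card assms by auto
  fix x assume "x \<in> \<xi> ` {..N}"
  then obtain j where j: "j \<le> N" "x = \<xi> j" by auto
  have "poly ?I x = (\<Sum>i\<le>N. if i = j then poly s (\<xi> i) else 0)"
    unfolding poly_sum using assms j by (intro sum.cong) (auto simp: lagrange_at_node)
  then show "poly ?I x = poly s x" using j by simp
qed

lemma lgl_inj_on: "lgl_nodes N \<xi> \<Longrightarrow> inj_on \<xi> {..N}"
  by (simp add: lgl_nodes_def strict_mono_on_imp_inj_on)

text \<open>
  The nodes are the zeros of \<open>(x\<^sup>2 - 1) P\<^sub>N'\<close>.  Division of \<open>p\<close> by this polynomial leaves a remainder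
  of degree at most \<open>N\<close>, which has the same nodal values as \<open>p\<close> and is integrated exactly; the
  multiple of \<open>(x\<^sup>2 - 1) P\<^sub>N'\<close> integrates to zero, because one integration by parts turns it into
  \<open>P\<^sub>N\<close> tested with a polynomial of degree less than \<open>N\<close>.
\<close>

lemma lobatto_exact:
  assumes lgl: "lgl_nodes N \<xi>" and deg: "degree p < 2 * N"
  shows "(\<Sum>i\<le>N. weight N \<xi> i * poly p (\<xi> i)) = integral {-1..1} (poly p)"
proof -
  define w where "w = ([:-1, 0, 1:] :: real poly)"
  define q where "q = w * pderiv (legendre N)"
  define r where "r = p div q"
  define s where "s = p mod q"
  have N: "N \<ge> 1" using lgl by (simp add: lgl_nodes_def)
  have degP: "degree (pderiv (legendre N)) = N - 1" by (simp add: degree_pderiv degree_legendre)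
  have "pderiv (legendre N) \<noteq> 0" using N by (simp add: pderiv_eq_0_iff degree_legendre)
  moreover have w: "w \<noteq> 0" "degree w = 2" by (auto simp: w_def)
  ultimately have q: "q \<noteq> 0" "degree q = N + 1"
    using N by (auto simp: q_def degree_mult_eq degP)
  have p: "p = q * r + s" by (simp add: r_def s_def)
  have s: "degree s \<le> N"
    using degree_mod_less[of q p] q by (auto simp: s_def)
  have node: "poly q (\<xi> i) = 0" if "i \<le> N" for i
  proof -
    have "i = 0 \<or> i = N \<or> (0 < i \<and> i < N)" using that by auto
    then show ?thesis using lgl by (auto simp: q_def w_def lgl_nodes_def)
  qed
  have "integral {-1..1} (poly (q * r)) = 0"
  proof (cases "r = 0")
    case True
    then show ?thesis by (simp add: integral_poly_0)
  next
    case False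
    then have "degree (q * r) = degree r + N + 1" using q by (simp add: degree_mult_eq)
    then have "degree p = degree r + N + 1" using s by (simp add: p degree_add_eq_left)
    then have "degree (pderiv (w * r)) < N"
      using deg False N by (simp add: degree_pderiv degree_mult_eq w)
    then have "integral {-1..1} (poly (legendre N * pderiv (w * r))) = 0"
      by (simp add: legendre_orthogonal)
    moreover have "q * r = pderiv (legendre N) * (w * r)" by (simp add: q_def mult_ac)
    ultimately show ?thesis
      using integral_poly_by_parts[of "-1" 1 "legendre N" "w * r"] by (simp add: w_def)
  qed
  then have "integral {-1..1} (poly p) = integral {-1..1} (poly s)"
    using p integral_poly_add[of "-1" 1 "q * r" s] by simp
  also have "\<dots> = integral {-1..1} (poly (\<Sum>i\<le>N. smult (poly s (\<xi> i)) (lagrange N \<xi> i)))"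
    using lagrange_interpolation[OF lgl_inj_on[OF lgl] s] by simp
  also have "\<dots> = (\<Sum>i\<le>N. poly s (\<xi> i) * weight N \<xi> i)"
    by (simp add: integral_poly_sum_smult weight_def)
  also have "\<dots> = (\<Sum>i\<le>N. weight N \<xi> i * poly p (\<xi> i))"
    by (intro sum.cong) (auto simp: p node)
  finally show ?thesis by simp
qed

section \<open>Summation by parts\<close>

text \<open>
  The left-hand side is the quadrature of the derivative of \<open>l\<^sub>i l\<^sub>j\<close>, a polynomial of degree at most
  \<open>2N - 1\<close>, and hence equals its exact integral.
\<close>

lemma Qmat_summation_by_parts:
  assumes lgl: "lgl_nodes N \<xi>" and ij: "i \<le> N" "j \<le> N"
  shows "Qmat N \<xi> i j + Qmat N \<xi> j i =
    (if i = N \<and> j = N then 1 else 0) - (if i = 0 \<and> j = 0 then 1 else 0)"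
proof -
  let ?l = "lagrange N \<xi>"
  have N: "N \<ge> 1" "\<xi> 0 = -1" "\<xi> N = 1" using lgl by (auto simp: lgl_nodes_def)
  note at_node = lagrange_at_node[OF lgl_inj_on[OF lgl]]
  have "degree (?l i * ?l j) \<le> 2 * N"
    using degree_mult_le[of "?l i" "?l j"] degree_lagrange_le[of i N \<xi>] degree_lagrange_le[of j N \<xi>] ij
    by linarith
  then have deg: "degree (pderiv (?l i * ?l j)) < 2 * N" using N by (simp add: degree_pderiv)
  have "(\<Sum>k\<le>N. weight N \<xi> k * poly (pderiv (?l i * ?l j)) (\<xi> k)) =
      (\<Sum>k\<le>N. (if k = i then Qmat N \<xi> i j else 0) + (if k = j then Qmat N \<xi> j i else 0))"
    using ij by (intro sum.cong) (auto simp: pderiv_mult at_node Qmat_def Dmat_def algebra_simps)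
  also have "\<dots> = Qmat N \<xi> i j + Qmat N \<xi> j i"
    using ij by (simp add: sum.distrib)
  finally have "Qmat N \<xi> i j + Qmat N \<xi> j i = poly (?l i * ?l j) (\<xi> N) - poly (?l i * ?l j) (\<xi> 0)"
    using lobatto_exact[OF lgl deg] integral_poly_pderiv[of "-1" 1 "?l i * ?l j"] N by simp
  then show ?thesis using ij by (auto simp: at_node)
qed

text \<open>
  Only the symmetric part of \<open>Q\<close> acts on a symmetric two-point quantity, and it is supported at
  the two end nodes.
\<close>

lemma Qmat_symmetric_sum:
  fixes A :: "nat \<Rightarrow> nat \<Rightarrow> real"
  assumes lgl: "lgl_nodes N \<xi>" and sym: "\<And>i j. i \<le> N \<Longrightarrow> j \<le> N \<Longrightarrow> A i j = A j i"
  shows "2 * (\<Sum>i\<le>N. \<Sum>j\<le>N. Qmat N \<xi> i j * A i j) = A N N - A 0 0"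
proof -
  have "(\<Sum>i\<le>N. \<Sum>j\<le>N. Qmat N \<xi> i j * A i j) = (\<Sum>i\<le>N. \<Sum>j\<le>N. Qmat N \<xi> j i * A i j)"
    by (subst sum.swap) (auto intro!: sum.cong simp: sym)
  then have "2 * (\<Sum>i\<le>N. \<Sum>j\<le>N. Qmat N \<xi> i j * A i j) =
      (\<Sum>i\<le>N. \<Sum>j\<le>N. (Qmat N \<xi> i j + Qmat N \<xi> j i) * A i j)"
    by (simp add: sum.distrib distrib_right)
  also have "\<dots> = (\<Sum>i\<le>N. \<Sum>j\<le>N. (if j = N then if i = N then A N N else 0 else 0) -
      (if j = 0 then if i = 0 then A 0 0 else 0 else 0))"
    by (intro sum.cong refl) (auto simp: Qmat_summation_by_parts[OF lgl])
  also have "\<dots> = A N N - A 0 0"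
    by (simp add: sum_subtractf)
  finally show ?thesis .
qed

section \<open>The two-point total energy flux\<close>

lemma mean2_self [simp]: "mean2 x x = x"
  by (simp add: mean2_def scaleR_2[symmetric])

lemma linear_total_energy: "linear (\<lambda>u. total_energy u \<phi>)"
  by (rule linearI) (auto simp: total_energy_def energy_def dens_def algebra_simps)

lemmas total_energy_linear_simps =
  linear_0[OF linear_total_energy] linear_add[OF linear_total_energy]
  linear_diff[OF linear_total_energy] linear_neg[OF linear_total_energy]
  linear_scale[OF linear_total_energy] linear_sum[OF linear_total_energy]

lemma total_energy_contract:
  "total_energy (contract F n) \<phi> = (\<Sum>c\<in>UNIV. n $ c * total_energy (F c) \<phi>)"
  by (simp add: contract_def total_energy_linear_simps)

text \<open>
  The flux of total energy through a face with metric vector \<open>n\<close>: the energy component of the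
  conservative flux plus the density component times the arithmetic mean of the potentials.
\<close>

definition energy_flux :: "cons_flux \<Rightarrow> interface_flux" where
  "energy_flux f a \<phi>a b \<phi>b n = total_energy (contract (\<lambda>c. f c a b) n) (mean2 \<phi>a \<phi>b)"

lemma energy_flux_commute:
  assumes "symmetric_flux \<gamma> f" "admissible \<gamma> a" "admissible \<gamma> b"
  shows "energy_flux f a \<phi>a b \<phi>b n = energy_flux f b \<phi>b a \<phi>a n"
proof -
  have "f c a b = f c b a" for c
    using assms unfolding symmetric_flux_def by blast
  then show ?thesis by (simp add: energy_flux_def mean2_def add.commute)
qed

text \<open>
  Weighting the mass balance with the own potential \<open>\<phi>a\<close> gives \<open>f\<^sup>\<rho> \<phi>a\<close>; half of the energy
  component \<open>f\<^sup>\<rho> (\<phi>b - \<phi>a)\<close> of the non-conservative term replaces \<open>\<phi>a\<close> by the mean of \<open>\<phi>a\<close>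
  and \<open>\<phi>b\<close> and so restores symmetry.
\<close>

lemma noncons_gives_energy_flux:
  assumes "\<And>c. dens (g c) = 0" and "\<And>c. energy (g c) = dens (f c a b) * jump \<phi>a \<phi>b"
  shows "total_energy (contract (\<lambda>c. f c a b) n) \<phi>a + 1/2 * total_energy (contract g n) \<phi>a =
    energy_flux f a \<phi>a b \<phi>b n"
  unfolding energy_flux_def total_energy_contract sum_distrib_left sum.distrib[symmetric]
  by (intro sum.cong refl)
     (simp add: total_energy_def assms jump_def mean2_def field_simps)

section \<open>Energy balance along a line of nodes\<close>

text \<open>The nodes are partitioned into lines in direction \<open>d\<close>, labelled by their lower end node.\<close>

lemma sum_nodes_lines:
  fixes h :: "node \<Rightarrow> real"
  shows "(\<Sum>q\<in>nodes N. h q) = (\<Sum>q\<in>{q\<in>nodes N. q d = 0}. \<Sum>i\<le>N. h (q(d := i)))"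
proof -
  have "bij_betw (\<lambda>(q, i). q(d := i)) ({q\<in>nodes N. q d = 0} \<times> {..N}) (nodes N)"
    by (rule bij_betw_byWitness[where f' = "\<lambda>q. (q(d := 0), q d)"])
       (auto simp: nodes_def fun_upd_idem)
  then have "(\<Sum>q\<in>nodes N. h q) = (\<Sum>(q, i)\<in>{q\<in>nodes N. q d = 0} \<times> {..N}. h (q(d := i)))"
    by (simp add: sum.reindex_bij_betw[symmetric] case_prod_unfold)
  then show ?thesis by (simp add: sum.cartesian_product)
qed

text \<open>
  Summed along a line of nodes, the volume terms collapse by summation by parts to the exact fluxes
  at the two ends, which cancel against the exact fluxes in the surface terms; only the two
  numerical interface fluxes survive.
\<close>

lemma line_energy_balance:
  assumes lgl: "lgl_nodes N \<xi>" and conf: "conforming_mesh N M" and e: "e \<in> elems M"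
    and q: "q \<in> nodes N" "q d = 0"
    and adm: "\<And>r. r \<in> nodes N \<Longrightarrow> admissible \<gamma> (u e r)"
    and adm_nbr: "\<And>s r. r \<in> nodes N \<Longrightarrow> r d = face_index N s \<Longrightarrow>
      admissible \<gamma> (u (nbr M s d e) (nbr_node N s d r))"
    and sym: "symmetric_flux \<gamma> fvol" and cons: "consistent_flux \<gamma> fvol"
    and gvol: "\<And>c a \<phi>a b \<phi>b. admissible \<gamma> a \<Longrightarrow> admissible \<gamma> b \<Longrightarrow>
      dens (gvol c a \<phi>a b \<phi>b) = 0 \<and> energy (gvol c a \<phi>a b \<phi>b) = dens (fvol c a b) * jump \<phi>a \<phi>b"
    and gsur: "\<And>c a \<phi>a b \<phi>b. admissible \<gamma> a \<Longrightarrow> admissible \<gamma> b \<Longrightarrow>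
      dens (gsur c a \<phi>a b \<phi>b) = 0 \<and> energy (gsur c a \<phi>a b \<phi>b) = dens (fsur c a b) * jump \<phi>a \<phi>b"
  shows "(\<Sum>i\<le>N. total_energy (rhs \<gamma> fvol gvol fsur gsur N \<xi> M u d e (q(d := i))) (phi M e (q(d := i)))) =
    - (face_weight N \<xi> d q *
        (interface_value (energy_flux fsur) N M u Upper d e (q(d := N))
         - interface_value (energy_flux fsur) N M u Lower d e q))"
proof -
  define p where "p i = q(d := i)" for i
  define A where "A i m = energy_flux fvol (u e (p i)) (phi M e (p i)) (u e (p m)) (phi M e (p m))
    (mean2 (metric M e d (p i)) (metric M e d (p m)))" for i m
  define B where "B i = total_energy (own_f \<gamma> M u d e (p i)) (phi M e (p i))" for i
  define H where "H s i = interface_value (energy_flux fsur) N M u s d e (p i)" for s i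
  define w where "w = face_weight N \<xi> d q"
  have N: "N \<ge> 1" using lgl by (simp add: lgl_nodes_def)
  have p_nodes: "p i \<in> nodes N" if "i \<le> N" for i
    using q that by (auto simp: p_def nodes_def)
  have p_d: "p i d = i" "(p i)(d := m) = p m" for i m by (auto simp: p_def)
  have fw: "face_weight N \<xi> d (p i) = w" for i
    by (auto simp: w_def face_weight_def p_def intro!: prod.cong)
  have vol: "total_energy (vol_f fvol M u d e (p i) (p m)) (phi M e (p i))
      + 1/2 * total_energy (vol_g gvol M u d e (p i) (p m)) (phi M e (p i)) = A i m"
    if "i \<le> N" "m \<le> N" for i m
    unfolding vol_f_def vol_g_def A_def
    by (rule noncons_gives_energy_flux) (use gvol adm p_nodes that in auto)
  have sur: "total_energy (surf_f fsur N M u s d e (p i)) (phi M e (p i))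
      + 1/2 * total_energy (surf_g gsur N M u s d e (p i)) (phi M e (p i)) = H s i"
    if "i = face_index N s" for s i
  proof -
    have i: "i \<le> N" using that by (cases s) auto
    have "metric M (nbr M s d e) d (nbr_node N s d (p i)) = metric M e d (p i)"
      using conf e p_nodes[OF i] p_d that unfolding conforming_mesh_def by blast
    then have m: "mean2 (metric M e d (p i)) (metric M (nbr M s d e) d (nbr_node N s d (p i)))
        = metric M e d (p i)"
      by simp
    have "admissible \<gamma> (u e (p i))" "admissible \<gamma> (u (nbr M s d e) (nbr_node N s d (p i)))"
      using adm adm_nbr p_nodes[OF i] p_d that by auto
    then show ?thesis
      unfolding surf_f_def surf_g_def H_def interface_value_def Let_def m
      by (intro noncons_gives_energy_flux) (use gsur in auto)
  qed
  have "A i i = B i" if "i \<le> N" for i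
  proof -
    have "fvol c (u e (p i)) (u e (p i)) = exact_flux \<gamma> c (u e (p i))" for c
      using cons adm[OF p_nodes[OF that]] unfolding consistent_flux_def by blast
    then show ?thesis by (simp add: A_def B_def energy_flux_def own_f_def)
  qed
  moreover have "A i m = A m i" if "i \<le> N" "m \<le> N" for i m
    using energy_flux_commute[OF sym adm[OF p_nodes[OF that(1)]] adm[OF p_nodes[OF that(2)]]]
    by (simp add: A_def mean2_def add.commute)
  ultimately have sbp: "2 * (\<Sum>i\<le>N. \<Sum>m\<le>N. Qmat N \<xi> i m * A i m) = B N - B 0"
    using Qmat_symmetric_sum[OF lgl, of A] by simp
  have node: "total_energy (rhs \<gamma> fvol gvol fsur gsur N \<xi> M u d e (p i)) (phi M e (p i)) =
      w * (- 2 * (\<Sum>m\<le>N. Qmat N \<xi> i m * A i m)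
        + (if i = N then B N - H Upper N else 0) + (if i = 0 then H Lower 0 - B 0 else 0))"
    if i: "i \<le> N" for i
  proof -
    have "2 * (\<Sum>m\<le>N. Qmat N \<xi> i m * A i m) =
        2 * (\<Sum>m\<le>N. Qmat N \<xi> i m * total_energy (vol_f fvol M u d e (p i) (p m)) (phi M e (p i)))
        + (\<Sum>m\<le>N. Qmat N \<xi> i m * total_energy (vol_g gvol M u d e (p i) (p m)) (phi M e (p i)))"
      unfolding sum_distrib_left sum.distrib[symmetric]
      by (intro sum.cong refl) (use i in \<open>simp add: vol[symmetric] algebra_simps\<close>)
    then show ?thesis
      using sur[of N Upper] sur[of 0 Lower] N
      by (simp add: rhs_def total_energy_linear_simps p_d fw B_def)
  qed
  have "(\<Sum>i\<le>N. total_energy (rhs \<gamma> fvol gvol fsur gsur N \<xi> M u d e (p i)) (phi M e (p i))) =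
      w * (- (2 * (\<Sum>i\<le>N. \<Sum>m\<le>N. Qmat N \<xi> i m * A i m)) + (B N - H Upper N) + (H Lower 0 - B 0))"
    by (simp add: node sum_distrib_left[symmetric] sum.distrib sum_negf sum_subtractf)
  also have "\<dots> = - (w * (H Upper N - H Lower 0))"
    unfolding sbp by (simp add: algebra_simps)
  finally show ?thesis
    using q by (simp add: p_def w_def H_def fun_upd_idem)
qed

text \<open>
  Seen from the upper neighbour, the own and the neighbouring node change places, and the face
  metric vector stays the same.
\<close>

lemma energy_flux_single_valued:
  assumes conf: "conforming_mesh N M" and e: "e \<in> elems M" "nbr M Upper d e \<in> elems M"
    and q: "q \<in> nodes N" "q d = N"
    and adm: "admissible \<gamma> (u e q)" "admissible \<gamma> (u (nbr M Upper d e) (nbr_node N Upper d q))"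
    and sym: "symmetric_flux \<gamma> f"
  shows "interface_value (energy_flux f) N M u Upper d e q =
    interface_value (energy_flux f) N M u Lower d (nbr M Upper d e) (q(d := 0))"
proof -
  have nbr: "nbr M Lower d (nbr M Upper d e) = e"
    using conf e unfolding conforming_mesh_def by (metis opp.simps(2))
  have metric: "metric M (nbr M Upper d e) d (q(d := 0)) = metric M e d q"
    using conf e q unfolding conforming_mesh_def
    by (metis face_index.simps nbr_node_def opp.simps(2))
  have "nbr_node N Upper d q = q(d := 0)" "nbr_node N Lower d (q(d := 0)) = q"
    using q by (auto simp: nbr_node_def)
  then show ?thesis
    using energy_flux_commute[OF sym adm] by (simp add: interface_value_def Let_def nbr metric)
qed

section \<open>Conservation of total energy\<close>

theorem theorem6p2:
  fixes \<gamma> :: real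
    and \<rho>m :: "real \<Rightarrow> real \<Rightarrow> real"
    and fvol fsur :: cons_flux
    and gvol gsur :: noncons_flux
  assumes "\<gamma> > 1"
    and "density_mean \<rho>m"
    and "symmetric_flux \<gamma> fvol" and "consistent_flux \<gamma> fvol"
    and "symmetric_flux \<gamma> fsur" and "consistent_flux \<gamma> fsur"
    and "\<And>d a b. admissible \<gamma> a \<Longrightarrow> admissible \<gamma> b \<Longrightarrow>
           dens (fvol d a b) = \<rho>m (dens a) (dens b) * mean2 (vel a $ d) (vel b $ d)"
    and "\<And>d a b. admissible \<gamma> a \<Longrightarrow> admissible \<gamma> b \<Longrightarrow>
           dens (fsur d a b) = \<rho>m (dens a) (dens b) * mean2 (vel a $ d) (vel b $ d)"
    and "\<And>d a \<phi>a b \<phi>b. admissible \<gamma> a \<Longrightarrow> admissible \<gamma> b \<Longrightarrow>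
           gvol d a \<phi>a b \<phi>b =
             (0, (\<rho>m (dens a) (dens b) * jump \<phi>a \<phi>b) *\<^sub>R axis d 1,
              dens (fvol d a b) * jump \<phi>a \<phi>b)"
    and "\<And>d a \<phi>a b \<phi>b. admissible \<gamma> a \<Longrightarrow> admissible \<gamma> b \<Longrightarrow>
           gsur d a \<phi>a b \<phi>b =
             (0, (\<rho>m (dens a) (dens b) * jump \<phi>a \<phi>b) *\<^sub>R axis d 1,
              dens (fsur d a b) * jump \<phi>a \<phi>b)"
  shows "total_energy_conservative \<gamma> fvol gvol fsur gsur"
proof -
  let ?rhs = "rhs \<gamma> fvol gvol fsur gsur"
  have gvol: "dens (gvol c a \<phi>a b \<phi>b) = 0 \<and> energy (gvol c a \<phi>a b \<phi>b) = dens (fvol c a b) * jump \<phi>a \<phi>b"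
    if "admissible \<gamma> a" "admissible \<gamma> b" for c a \<phi>a b \<phi>b
    using assms(9)[OF that] by (simp add: dens_def energy_def)
  have gsur: "dens (gsur c a \<phi>a b \<phi>b) = 0 \<and> energy (gsur c a \<phi>a b \<phi>b) = dens (fsur c a b) * jump \<phi>a \<phi>b"
    if "admissible \<gamma> a" "admissible \<gamma> b" for c a \<phi>a b \<phi>b
    using assms(10)[OF that] by (simp add: dens_def energy_def)
  show ?thesis
    unfolding total_energy_conservative_def
  proof (intro exI[where x = "energy_flux fsur"] allI impI ballI conjI)
    fix N \<xi> M T u t e d q
    assume "lgl_nodes N \<xi>" and conf: "conforming_mesh N M"
      and sol: "dgsem_solution \<gamma> fvol gvol fsur gsur N \<xi> M T u"
      and t: "t \<in> T" and e: "e \<in> elems M" and q: "q \<in> nodes N" "q d = N"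
      and e': "nbr M Upper d e \<in> elems M"
    have "admissible \<gamma> (u t e q)" using sol t e q by (simp add: dgsem_solution_def)
    moreover have "admissible \<gamma> (u t (nbr M Upper d e) (nbr_node N Upper d q))"
      using sol t e q unfolding dgsem_solution_def by (metis face_index.simps(2))
    ultimately show "interface_value (energy_flux fsur) N M (u t) Upper d e q =
        interface_value (energy_flux fsur) N M (u t) Lower d (nbr M Upper d e) (q(d := 0))"
      by (rule energy_flux_single_valued[OF conf e e' q _ _ assms(5)])
  next
    fix N \<xi> M T u t e
    assume lgl: "lgl_nodes N \<xi>" and conf: "conforming_mesh N M"
      and sol: "dgsem_solution \<gamma> fvol gvol fsur gsur N \<xi> M T u"
      and t: "t \<in> T" and e: "e \<in> elems M"
    let ?W = "\<lambda>q. jac M e q * vol_weight N \<xi> q"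
    have "\<forall>q\<in>nodes N. \<exists>du. ((\<lambda>\<tau>. u \<tau> e q) has_vector_derivative du) (at t within T) \<and>
        ?W q *\<^sub>R du = (\<Sum>d\<in>UNIV. ?rhs N \<xi> M (u t) d e q)"
      using sol t e unfolding dgsem_solution_def by blast
    then obtain du where
      deriv: "\<And>q. q \<in> nodes N \<Longrightarrow> ((\<lambda>\<tau>. u \<tau> e q) has_vector_derivative du q) (at t within T)"
      and du: "\<And>q. q \<in> nodes N \<Longrightarrow> ?W q *\<^sub>R du q = (\<Sum>d\<in>UNIV. ?rhs N \<xi> M (u t) d e q)"
      by metis
    have "((\<lambda>\<tau>. total_energy (u \<tau> e q) (phi M e q)) has_real_derivative
        total_energy (du q) (phi M e q)) (at t within T)" if "q \<in> nodes N" for q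
      unfolding has_real_derivative_iff_has_vector_derivative
      by (rule bounded_linear.has_vector_derivative[OF _ deriv[OF that]])
         (simp add: linear_total_energy linear_conv_bounded_linear[symmetric])
    then have "((\<lambda>\<tau>. \<Sum>q\<in>nodes N. ?W q * total_energy (u \<tau> e q) (phi M e q)) has_real_derivative
        (\<Sum>q\<in>nodes N. ?W q * total_energy (du q) (phi M e q))) (at t within T)"
      by (intro DERIV_sum DERIV_cmult)
    moreover have "(\<Sum>q\<in>nodes N. ?W q * total_energy (du q) (phi M e q)) =
        - (\<Sum>d\<in>UNIV. \<Sum>q\<in>{q\<in>nodes N. q d = 0}. face_weight N \<xi> d q *
            (interface_value (energy_flux fsur) N M (u t) Upper d e (q(d := N))
             - interface_value (energy_flux fsur) N M (u t) Lower d e q))"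
    proof -
      have "(\<Sum>q\<in>nodes N. ?W q * total_energy (du q) (phi M e q)) =
          (\<Sum>q\<in>nodes N. \<Sum>d\<in>UNIV. total_energy (?rhs N \<xi> M (u t) d e q) (phi M e q))"
      proof (intro sum.cong refl)
        fix q assume "q \<in> nodes N"
        have "?W q * total_energy (du q) (phi M e q) = total_energy (?W q *\<^sub>R du q) (phi M e q)"
          by (simp add: total_energy_linear_simps)
        also have "\<dots> = (\<Sum>d\<in>UNIV. total_energy (?rhs N \<xi> M (u t) d e q) (phi M e q))"
          unfolding du[OF \<open>q \<in> nodes N\<close>] by (simp add: total_energy_linear_simps)
        finally show "?W q * total_energy (du q) (phi M e q) =
            (\<Sum>d\<in>UNIV. total_energy (?rhs N \<xi> M (u t) d e q) (phi M e q))" .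
      qed
      also have "\<dots> = (\<Sum>d\<in>UNIV. \<Sum>q\<in>{q\<in>nodes N. q d = 0}. \<Sum>i\<le>N.
          total_energy (?rhs N \<xi> M (u t) d e (q(d := i))) (phi M e (q(d := i))))"
        by (subst sum.swap) (intro sum.cong refl sum_nodes_lines)
      also have "\<dots> = (\<Sum>d\<in>UNIV. \<Sum>q\<in>{q\<in>nodes N. q d = 0}. - (face_weight N \<xi> d q *
            (interface_value (energy_flux fsur) N M (u t) Upper d e (q(d := N))
             - interface_value (energy_flux fsur) N M (u t) Lower d e q)))"
      proof (intro sum.cong refl line_energy_balance[OF lgl conf e])
        show "symmetric_flux \<gamma> fvol" "consistent_flux \<gamma> fvol" by fact+
        show "admissible \<gamma> (u t e r)" if "r \<in> nodes N" for r
          using sol t e that by (simp add: dgsem_solution_def)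
        show "admissible \<gamma> (u t (nbr M s d e) (nbr_node N s d r))"
          if "r \<in> nodes N" "r d = face_index N s" for d s r
          using sol t e that unfolding dgsem_solution_def by blast
      qed (use gvol gsur in auto)
      also have "\<dots> = - (\<Sum>d\<in>UNIV. \<Sum>q\<in>{q\<in>nodes N. q d = 0}. face_weight N \<xi> d q *
            (interface_value (energy_flux fsur) N M (u t) Upper d e (q(d := N))
             - interface_value (energy_flux fsur) N M (u t) Lower d e q))"
        by (simp only: sum_negf)
      finally show ?thesis .
    qed
    ultimately show "((\<lambda>\<tau>. \<Sum>q\<in>nodes N. ?W q * total_energy (u \<tau> e q) (phi M e q)) has_real_derivative
        - (\<Sum>d\<in>UNIV. \<Sum>q\<in>{q\<in>nodes N. q d = 0}. face_weight N \<xi> d q *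
            (interface_value (energy_flux fsur) N M (u t) Upper d e (q(d := N))
             - interface_value (energy_flux fsur) N M (u t) Lower d e q))) (at t within T)"
      by simp
  qed
qed

end
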